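(* Let $\mathcal{P}$ be a finite-dimensional $\phi$-free Poisson algebra over an arbitrary field $\mathbb{F}$. Then $Zsoc(\mathcal{P})=N(\mathcal{P})=Ann_{\mathcal{P}}(Soc(\mathcal{P}))$.
   Context: A Poisson algebra $(\mathcal{P},\cdot,[\cdot,\cdot])$ over $\mathbb{F}$ is a vector space with two bilinear products such that $(\mathcal{P},\cdot)$ is a commutative associative algebra (not necessarily unital), $(\mathcal{P},[\cdot,\cdot])$ is a Lie algebra, and $[x\cdot y,z]=[x,z]\cdot y+x\cdot[y,z]$ for all $x,y,z$. A subalgebra is a subspace closed under both products; an ideal is a subspace $I$ with $I\cdot\mathcal{P}+[I,\mathcal{P}]\subseteq I$; a zero ideal is an ideal $I$ with $I\cdot I+[I,I]=0$. The socle $Soc(\mathcal{P})$ is the sum of the minimal (nonzero) ideals of $\mathcal{P}$; the zero socle $Zsoc(\mathcal{P})$ is the sum of those minimal ideals that are zero ideals. The nilradical $N(\mathcal{P})$ is the largest nilpotent ideal of $\mathcal{P}$, where a Poisson algebra $A$ is nilpotent if $A^m=0$ for some $m$, with $A^1=A$ and $A^{n+1}=\sum_{i=1}^{n}(A^i\cdot A^{n+1-i}+[A^i,A^{n+1-i}])$ (products of subspaces are linear spans). For a subalgebra $B$, $Ann_{\mathcal{P}}(B)=\{x\in\mathcal{P}\mid x\cdot B+[x,B]=0\}$. The Frattini subalgebra $F(\mathcal{P})$ is the intersection of the maximal (proper) subalgebras of $\mathcal{P}$, the Frattini ideal $\phi(\mathcal{P})$ is the largest ideal of $\mathcal{P}$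 contained in $F(\mathcal{P})$, and $\mathcal{P}$ is $\phi$-free if $\phi(\mathcal{P})=0$. *)

theory Defs
  imports Complex_Main
begin

locale poisson_algebra = vector_space scale
  for scale :: "'k::field \<Rightarrow> 'p::ab_group_add \<Rightarrow> 'p" +
  fixes mult :: "'p \<Rightarrow> 'p \<Rightarrow> 'p"
    and bracket :: "'p \<Rightarrow> 'p \<Rightarrow> 'p"
  assumes mult_linear_left: "Vector_Spaces.linear scale scale (\<lambda>x. mult x y)"
    and mult_linear_right: "Vector_Spaces.linear scale scale (\<lambda>y. mult x y)"
    and mult_commute: "mult x y = mult y x"
    and mult_assoc: "mult (mult x y) z = mult x (mult y z)"
    and bracket_linear_left: "Vector_Spaces.linear scale scale (\<lambda>x. bracket x y)"
    and bracket_linear_right: "Vector_Spaces.linear scale scale (\<lambda>y. bracket x y)"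
    and bracket_self: "bracket x x = 0"
    and jacobi: "bracket x (bracket y z) + bracket y (bracket z x) + bracket z (bracket x y) = 0"
    and leibniz: "bracket (mult x y) z = mult (bracket x z) y + mult x (bracket y z)"
begin

definition subalgebra :: "'p set \<Rightarrow> bool" where
  "subalgebra B \<longleftrightarrow> subspace B \<and> (\<forall>x\<in>B. \<forall>y\<in>B. mult x y \<in> B \<and> bracket x y \<in> B)"

text \<open>The subspace \<open>A\<cdot>B + [A,B]\<close>; products and sums of subspaces are linear spans.\<close>

definition sprod :: "'p set \<Rightarrow> 'p set \<Rightarrow> 'p set" where
  "sprod A B = span ({mult x y | x y. x \<in> A \<and> y \<in> B} \<union> {bracket x y | x y. x \<in> A \<and> y \<in> B})"

definition ideal :: "'p set \<Rightarrow> bool" where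
  "ideal I \<longleftrightarrow> subspace I \<and> sprod I UNIV \<subseteq> I"

definition zero_ideal :: "'p set \<Rightarrow> bool" where
  "zero_ideal I \<longleftrightarrow> ideal I \<and> sprod I I = {0}"

definition minimal_ideal :: "'p set \<Rightarrow> bool" where
  "minimal_ideal I \<longleftrightarrow> ideal I \<and> I \<noteq> {0} \<and> (\<forall>J. ideal J \<and> J \<subseteq> I \<longrightarrow> J = {0} \<or> J = I)"

definition socle :: "'p set" where
  "socle = span (\<Union>{I. minimal_ideal I})"

definition zero_socle :: "'p set" where
  "zero_socle = span (\<Union>{I. minimal_ideal I \<and> zero_ideal I})"

text \<open>\<open>pow A n\<close> is \<open>A\<^sup>n\<close> for \<open>n \<ge> 1\<close>; the value \<open>pow A 0 = A\<close> is a dummy.\<close>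

fun pow :: "'p set \<Rightarrow> nat \<Rightarrow> 'p set" where
  "pow A 0 = A"
| "pow A (Suc 0) = A"
| "pow A (Suc (Suc n)) =
    span (\<Union>i\<in>{1..Suc n}. sprod (pow A i) (pow A (Suc (Suc n) - i)))"

definition nilpotent :: "'p set \<Rightarrow> bool" where
  "nilpotent A \<longleftrightarrow> (\<exists>m\<ge>1. pow A m = {0})"

text \<open>Largest is meant with respect to inclusion.\<close>

definition nilradical :: "'p set" where
  "nilradical = (GREATEST I. ideal I \<and> nilpotent I)"

definition annihilator :: "'p set \<Rightarrow> 'p set" where
  "annihilator B = {x. \<forall>b\<in>B. mult x b = 0 \<and> bracket x b = 0}"

definition maximal_subalgebra :: "'p set \<Rightarrow> bool" where
  "maximal_subalgebra M \<longleftrightarrow> subalgebra M \<and> M \<noteq> UNIV \<and>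
    (\<forall>B. subalgebra B \<and> M \<subseteq> B \<longrightarrow> B = M \<or> B = UNIV)"

text \<open>With no maximal subalgebra the intersection is the whole algebra; in finite dimension
  this happens only for the zero algebra.\<close>

definition frattini_subalgebra :: "'p set" where
  "frattini_subalgebra = \<Inter>{M. maximal_subalgebra M}"

definition frattini_ideal :: "'p set" where
  "frattini_ideal = (GREATEST I. ideal I \<and> I \<subseteq> frattini_subalgebra)"

definition phi_free :: bool where
  "phi_free \<longleftrightarrow> frattini_ideal = {0}"

lemma ideal_iff:
  "ideal I \<longleftrightarrow> subspace I \<and> (\<forall>x\<in>I. \<forall>y. mult x y \<in> I \<and> bracket x y \<in> I)"
proof
  assume I: "ideal I"
  have "mult x y \<in> sprod I UNIV \<and> bracket x y \<in> sprod I UNIV" if "x \<in> I" for x y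
    unfolding sprod_def using that by (intro conjI span_base) auto
  with I show "subspace I \<and> (\<forall>x\<in>I. \<forall>y. mult x y \<in> I \<and> bracket x y \<in> I)"
    unfolding ideal_def by blast
next
  assume "subspace I \<and> (\<forall>x\<in>I. \<forall>y. mult x y \<in> I \<and> bracket x y \<in> I)"
  then show "ideal I"
    unfolding ideal_def sprod_def by (intro conjI span_minimal) blast+
qed

lemma ideal_span_Union:
  assumes "\<And>I. I \<in> \<I> \<Longrightarrow> ideal I"
  shows "ideal (span (\<Union>\<I>))"
proof -
  have mem: "f x \<in> span (\<Union>\<I>)"
    if f: "Vector_Spaces.linear scale scale f" and cl: "\<And>I x. I \<in> \<I> \<Longrightarrow> x \<in> I \<Longrightarrow> f x \<in> I"
      and x: "x \<in> span (\<Union>\<I>)" for f x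
  proof -
    interpret f: Vector_Spaces.linear scale scale f by (rule f)
    from x show ?thesis
    proof (induction rule: span_induct_alt)
      case base
      show ?case by (simp add: f.zero span_zero)
    next
      case (step c x y)
      then have "f x \<in> span (\<Union>\<I>)" using cl by (blast intro: span_base)
      with step show ?case by (simp add: f.add f.scale span_add span_scale)
    qed
  qed
  show ?thesis
    unfolding ideal_iff
    using assms by (auto simp: ideal_iff intro!: mem[OF mult_linear_left] mem[OF bracket_linear_left])
qed

lemma subspace_frattini_subalgebra: "subspace frattini_subalgebra"
  unfolding frattini_subalgebra_def
  by (rule subspace_Inter) (auto simp: maximal_subalgebra_def subalgebra_def)

text \<open>The largest ideal in the definition of the Frattini ideal exists.\<close>

lemma frattini_ideal_greatest:
  shows "ideal frattini_ideal" and "frattini_ideal \<subseteq> frattini_subalgebra"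
    and "\<And>I. ideal I \<Longrightarrow> I \<subseteq> frattini_subalgebra \<Longrightarrow> I \<subseteq> frattini_ideal"
proof -
  let ?S = "{I. ideal I \<and> I \<subseteq> frattini_subalgebra}"
  let ?J = "span (\<Union>?S)"
  have J: "ideal ?J" "?J \<subseteq> frattini_subalgebra"
    by (rule ideal_span_Union, blast) (rule span_minimal, blast, rule subspace_frattini_subalgebra)
  have max: "I \<subseteq> ?J" if "ideal I" "I \<subseteq> frattini_subalgebra" for I
    using that by (auto intro: span_base)
  have eq: "frattini_ideal = ?J"
    unfolding frattini_ideal_def by (rule Greatest_equality) (use J max in auto)
  show "ideal frattini_ideal" "frattini_ideal \<subseteq> frattini_subalgebra"
    and "\<And>I. ideal I \<Longrightarrow> I \<subseteq> frattini_subalgebra \<Longrightarrow> I \<subseteq> frattini_ideal"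
    unfolding eq using J max by blast+
qed

end

end

theory Submission
  imports Defs
begin

text \<open>
  Three inclusions are proved: the zero socle is a nilpotent ideal, every nilpotent ideal
  annihilates the socle, and in a \<open>\<phi>\<close>-free algebra the annihilator of the socle lies in the zero
  socle. Together they say that the zero socle is the largest nilpotent ideal and that it is the
  annihilator of the socle, so the existence of a largest one comes out of the same argument.

  Distinct minimal ideals annihilate each other, since their products lie in their intersection.
  Hence the zero socle is itself a zero ideal (\<open>zero_ideal_zero_socle\<close>). If \<open>N\<close> is a nilpotent ideal and \<open>I\<close> a minimal one,
  then \<open>I\<cdot>N + [I,N]\<close> is an ideal inside \<open>I\<close>, hence \<open>0\<close> or \<open>I\<close>. If it were \<open>I\<close>, then \<open>I\<close> would lie in
  all powers of \<open>N\<close> (\<open>subset_pow\<close>) and vanish, which a minimal ideal does not. So the product is \<open>0\<close>,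
  that is, \<open>N\<close> annihilates \<open>I\<close>.

  The \<open>\<phi>\<close>-free hypothesis enters through the fact that every zero ideal \<open>Z\<close> then has a complementary
  subalgebra \<open>B\<close> (\<open>zero_ideal_complement\<close>). Applied to the zero socle \<open>Z\<close>, it gives
  \<open>A = Z \<oplus> (A \<inter> B)\<close> for the annihilator \<open>A\<close> of the socle. Both \<open>Z\<close> and \<open>B\<close> map \<open>A \<inter> B\<close> to itself, so it
  is an ideal. A minimal ideal inside it would lie in the socle and in its annihilator, so it would
  be a zero ideal, hence contained in \<open>Z \<inter> B = 0\<close>. Therefore \<open>A \<inter> B = 0\<close> and \<open>A = Z\<close>.
\<close>

context poisson_algebra
begin

section \<open>Ideals, their products and annihilators\<close>

lemma mult_add_left: "mult (x + y) z = mult x z + mult y z"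
  and mult_scale_left: "mult (scale c x) z = scale c (mult x z)"
  and mult_zero_left: "mult 0 z = 0"
proof -
  interpret f: Vector_Spaces.linear scale scale "\<lambda>x. mult x z" by (rule mult_linear_left)
  show "mult (x + y) z = mult x z + mult y z" "mult (scale c x) z = scale c (mult x z)" "mult 0 z = 0"
    by (fact f.add f.scale f.zero)+
qed

lemma mult_add_right: "mult z (x + y) = mult z x + mult z y"
  by (simp add: mult_commute[of z] mult_add_left)

lemma bracket_add_left: "bracket (x + y) z = bracket x z + bracket y z"
  and bracket_scale_left: "bracket (scale c x) z = scale c (bracket x z)"
  and bracket_zero_left: "bracket 0 z = 0"
proof -
  interpret f: Vector_Spaces.linear scale scale "\<lambda>x. bracket x z" by (rule bracket_linear_left)
  show "bracket (x + y) z = bracket x z + bracket y z"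
    "bracket (scale c x) z = scale c (bracket x z)" "bracket 0 z = 0"
    by (fact f.add f.scale f.zero)+
qed

lemma bracket_add_right: "bracket z (x + y) = bracket z x + bracket z y"
  and bracket_minus_right: "bracket z (- x) = - bracket z x"
proof -
  interpret f: Vector_Spaces.linear scale scale "\<lambda>x. bracket z x" by (rule bracket_linear_right)
  show "bracket z (x + y) = bracket z x + bracket z y"
    "bracket z (- x) = - bracket z x"
    by (fact f.add f.neg)+
qed

lemma bracket_anticommute: "bracket x y = - bracket y x"
proof -
  have "0 = bracket (x + y) (x + y)" by (simp add: bracket_self)
  also have "\<dots> = bracket x y + bracket y x"
    unfolding bracket_add_left bracket_add_right by (simp add: bracket_self)
  finally show ?thesis by (metis eq_neg_iff_add_eq_0)
qed

lemma bracket_bracket: "bracket (bracket x y) z = bracket (bracket x z) y + bracket x (bracket y z)"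
proof -
  have "bracket x (bracket y z) + bracket y (bracket z x) + bracket z (bracket x y) = 0"
    by (rule jacobi)
  moreover have "bracket y (bracket z x) = bracket (bracket x z) y"
    by (metis bracket_anticommute bracket_minus_right)
  moreover have "bracket z (bracket x y) = - bracket (bracket x y) z" by (rule bracket_anticommute)
  ultimately show ?thesis by (simp add: algebra_simps)
qed

lemma mult_bracket: "mult (bracket x y) z = bracket (mult x z) y - mult x (bracket z y)"
  using leibniz[of x z y] by simp

lemma ideal_subspace: "ideal I \<Longrightarrow> subspace I"
  by (simp add: ideal_iff)

lemma ideal_absorb:
  assumes "ideal I" "x \<in> I"
  shows "mult x y \<in> I" "mult y x \<in> I" "bracket x y \<in> I" "bracket y x \<in> I"
proof -
  show "mult x y \<in> I" "bracket x y \<in> I" using assms by (auto simp: ideal_iff)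
  then show "mult y x \<in> I" "bracket y x \<in> I"
    using assms(1) by (auto simp: ideal_iff mult_commute[of y] bracket_anticommute[of y]
        intro: subspace_neg)
qed

lemma ideal_Int: "ideal I \<Longrightarrow> ideal J \<Longrightarrow> ideal (I \<inter> J)"
  by (auto simp: ideal_iff intro: subspace_inter)

lemma sprod_mem:
  assumes "x \<in> A" "y \<in> B"
  shows "mult x y \<in> sprod A B" "bracket x y \<in> sprod A B"
  unfolding sprod_def using assms by (auto intro!: span_base)

lemma sprod_subset:
  assumes "subspace C" "\<And>x y. x \<in> A \<Longrightarrow> y \<in> B \<Longrightarrow> mult x y \<in> C \<and> bracket x y \<in> C"
  shows "sprod A B \<subseteq> C"
  unfolding sprod_def by (rule span_minimal) (use assms in auto)

lemma sprod_eq_0_iff: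
  "sprod A B = {0} \<longleftrightarrow> (\<forall>x\<in>A. \<forall>y\<in>B. mult x y = 0 \<and> bracket x y = 0)"
proof
  assume "sprod A B = {0}"
  then show "\<forall>x\<in>A. \<forall>y\<in>B. mult x y = 0 \<and> bracket x y = 0" using sprod_mem by blast
next
  assume "\<forall>x\<in>A. \<forall>y\<in>B. mult x y = 0 \<and> bracket x y = 0"
  then have "sprod A B \<subseteq> {0}" by (intro sprod_subset) auto
  moreover have "0 \<in> sprod A B" by (simp add: sprod_def span_zero)
  ultimately show "sprod A B = {0}" by blast
qed

text \<open>Associativity, the Leibniz rule and the Jacobi identity move the outer factor into \<open>I\<close> or \<open>J\<close>.
  Combining both products is essential: multiplying a bracket gives
  \<open>[x,y]\<cdot>z = [x\<cdot>z,y] - x\<cdot>[z,y]\<close>, so the span of the brackets alone is closed only up to \<open>I\<cdot>J\<close>.\<close>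

lemma ideal_sprod:
  assumes I: "ideal I" and J: "ideal J"
  shows "ideal (sprod I J)"
proof -
  let ?S = "sprod I J"
  have sub: "subspace ?S" by (simp add: sprod_def)
  have "mult v z \<in> ?S \<and> bracket v z \<in> ?S" if "v \<in> ?S" for v z
  proof -
    have sv: "subspace {v. mult v z \<in> ?S \<and> bracket v z \<in> ?S}"
      using sub by (auto simp: subspace_def mult_add_left mult_scale_left mult_zero_left
          bracket_add_left bracket_scale_left bracket_zero_left)
    have "?S \<subseteq> {v. mult v z \<in> ?S \<and> bracket v z \<in> ?S}"
    proof (rule sprod_subset[OF sv], intro conjI CollectI)
      fix x y assume xy: "x \<in> I" "y \<in> J"
      note cl = ideal_absorb[OF I xy(1)] ideal_absorb[OF J xy(2)]
      show "mult (mult x y) z \<in> ?S" using xy cl by (simp add: mult_assoc sprod_mem)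
      show "bracket (mult x y) z \<in> ?S"
        unfolding leibniz using sub xy cl by (intro subspace_add sprod_mem)
      show "mult (bracket x y) z \<in> ?S"
        unfolding mult_bracket using sub xy cl by (intro subspace_diff sprod_mem)
      show "bracket (bracket x y) z \<in> ?S"
        unfolding bracket_bracket[of x y] using sub xy cl by (intro subspace_add sprod_mem)
    qed
    with that show ?thesis by blast
  qed
  with sub show ?thesis by (simp add: ideal_iff)
qed

lemma subspace_annihilator_of_element: "subspace {x. mult x b = 0 \<and> bracket x b = 0}"
  by (auto simp: subspace_def mult_add_left mult_scale_left mult_zero_left
      bracket_add_left bracket_scale_left bracket_zero_left)

lemma annihilator_commute: "A \<subseteq> annihilator B \<longleftrightarrow> B \<subseteq> annihilator A"
  unfolding annihilator_def subset_iff mem_Collect_eq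
  by (metis mult_commute bracket_anticommute neg_equal_0_iff_equal)

lemma subspace_annihilator: "subspace (annihilator B)"
proof -
  have "annihilator B = \<Inter>((\<lambda>b. {x. mult x b = 0 \<and> bracket x b = 0}) ` B)"
    by (auto simp: annihilator_def)
  then show ?thesis
    by (metis (no_types, lifting) imageE subspace_Inter subspace_annihilator_of_element)
qed

lemma subset_annihilator_span: "A \<subseteq> annihilator B \<Longrightarrow> A \<subseteq> annihilator (span B)"
  by (metis annihilator_commute span_minimal subspace_annihilator)

lemma ideal_annihilator:
  assumes "ideal B"
  shows "ideal (annihilator B)"
  unfolding ideal_iff
proof (intro conjI ballI allI)
  fix x y assume x: "x \<in> annihilator B"
  have x0: "mult x b = 0" "bracket x b = 0" if "b \<in> B" for b
    using x that by (auto simp: annihilator_def)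
  show "mult x y \<in> annihilator B"
    using ideal_absorb[OF assms]
    by (auto simp: annihilator_def mult_assoc leibniz x0 mult_zero_left)
  show "bracket x y \<in> annihilator B"
    using ideal_absorb[OF assms]
    by (auto simp: annihilator_def mult_bracket bracket_bracket[of x y] x0 bracket_zero_left)
qed (rule subspace_annihilator)

lemma zero_ideal_iff: "zero_ideal I \<longleftrightarrow> ideal I \<and> I \<subseteq> annihilator I"
  by (auto simp: zero_ideal_def sprod_eq_0_iff annihilator_def)

lemma nilpotent_zero_ideal:
  assumes "zero_ideal I"
  shows "nilpotent I"
  unfolding nilpotent_def
proof (intro exI conjI)
  have "pow I 2 = {0}" using assms by (simp add: numeral_2_eq_2 zero_ideal_def)
  then show "pow I 2 = {0}" .
qed simp

section \<open>The socle and nilpotent ideals\<close>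

lemma minimal_ideal_ideal: "minimal_ideal I \<Longrightarrow> ideal I"
  by (simp add: minimal_ideal_def)

lemma distinct_minimal_ideals_annihilate:
  assumes I: "minimal_ideal I" and J: "minimal_ideal J" and "I \<noteq> J"
  shows "I \<subseteq> annihilator J"
proof -
  have "ideal (I \<inter> J)" using I J by (simp add: ideal_Int minimal_ideal_ideal)
  then have "I \<inter> J = {0}"
    using I J \<open>I \<noteq> J\<close> unfolding minimal_ideal_def by (metis inf_le1 inf_le2)
  moreover have "mult x y \<in> I \<inter> J" "bracket x y \<in> I \<inter> J" if "x \<in> I" "y \<in> J" for x y
    using that I J by (simp_all add: ideal_absorb minimal_ideal_ideal)
  ultimately show ?thesis by (auto simp: annihilator_def)
qed

lemma ideal_socle: "ideal socle"
  unfolding socle_def by (rule ideal_span_Union) (simp add: minimal_ideal_ideal)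

lemma zero_socle_subset_socle: "zero_socle \<subseteq> socle"
  unfolding zero_socle_def socle_def by (rule span_mono) blast

lemma zero_ideal_zero_socle: "zero_ideal zero_socle"
proof -
  let ?U = "\<Union>{I. minimal_ideal I \<and> zero_ideal I}"
  have "ideal zero_socle"
    unfolding zero_socle_def by (rule ideal_span_Union) (simp add: minimal_ideal_ideal)
  moreover have "I \<subseteq> annihilator J"
    if "minimal_ideal I" "zero_ideal I" "minimal_ideal J" for I J
    using that distinct_minimal_ideals_annihilate zero_ideal_iff by (cases "I = J") auto
  then have "?U \<subseteq> annihilator ?U" unfolding annihilator_def by blast
  then have "?U \<subseteq> annihilator (span ?U)" by (rule subset_annihilator_span)
  then have "zero_socle \<subseteq> annihilator zero_socle"
    unfolding zero_socle_def by (intro span_minimal subspace_annihilator)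
  ultimately show ?thesis by (simp add: zero_ideal_iff)
qed

text \<open>An analogue of Nakayama's lemma: an ideal reproduced by multiplication with a nilpotent set
  \<open>N\<close> descends through all powers of \<open>N\<close>.\<close>

lemma subset_pow:
  assumes "I \<subseteq> N" "I \<subseteq> sprod I N" "n \<ge> 1"
  shows "I \<subseteq> pow N n"
  using assms(3)
proof (induction n rule: dec_induct)
  case base
  show ?case using assms(1) by simp
next
  case (step n)
  then obtain k where n: "n = Suc k" by (cases n) auto
  have "sprod I N \<subseteq> sprod (pow N n) N"
    unfolding sprod_def by (rule span_mono) (use step.IH in blast)
  also have "\<dots> \<subseteq> (\<Union>i\<in>{1..Suc k}. sprod (pow N i) (pow N (Suc (Suc k) - i)))"
    by (rule order_trans[OF _ UN_upper[where a = "Suc k"]]) (simp_all add: n)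
  also have "\<dots> \<subseteq> pow N (Suc n)" unfolding n pow.simps by (rule span_superset)
  finally show ?case using assms(2) by blast
qed

lemma nilpotent_ideal_annihilates_minimal_ideal:
  assumes N: "ideal N" "nilpotent N" and I: "minimal_ideal I"
  shows "I \<subseteq> annihilator N"
proof -
  have idI: "ideal I" using I by (rule minimal_ideal_ideal)
  have subI: "sprod I N \<subseteq> I" and subN: "sprod I N \<subseteq> N"
    by (rule sprod_subset; simp add: idI N(1) ideal_subspace ideal_absorb)+
  have "sprod I N = {0} \<or> sprod I N = I"
    using I ideal_sprod[OF idI N(1)] subI by (auto simp: minimal_ideal_def)
  moreover have "sprod I N \<noteq> I"
  proof
    assume eq: "sprod I N = I"
    obtain m where "m \<ge> 1" "pow N m = {0}" using N(2) by (auto simp: nilpotent_def)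
    then have "I \<subseteq> {0}" using subset_pow[of I N m] eq subN by simp
    moreover have "0 \<in> I" using idI by (simp add: ideal_subspace subspace_0)
    ultimately show False using I by (auto simp: minimal_ideal_def)
  qed
  ultimately show ?thesis by (auto simp: sprod_eq_0_iff annihilator_def)
qed

lemma nilpotent_ideal_subset_annihilator_socle:
  assumes "ideal N" "nilpotent N"
  shows "N \<subseteq> annihilator socle"
proof -
  have "\<Union>{I. minimal_ideal I} \<subseteq> annihilator N"
    using nilpotent_ideal_annihilates_minimal_ideal[OF assms] by blast
  then show ?thesis unfolding socle_def by (metis annihilator_commute subset_annihilator_span)
qed

section \<open>Splitting off zero ideals\<close>

lemma subalgebra_subspace: "subalgebra B \<Longrightarrow> subspace B"
  by (simp add: subalgebra_def)

lemma subalgebra_Int: "subalgebra A \<Longrightarrow> subalgebra B \<Longrightarrow> subalgebra (A \<inter> B)"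
  by (auto simp: subalgebra_def intro: subspace_inter)

lemma subalgebra_sum_ideal:
  assumes M: "subalgebra M" and I: "ideal I"
  shows "subalgebra {x + y |x y. x \<in> M \<and> y \<in> I}"
  unfolding subalgebra_def
proof (intro conjI ballI)
  show "subspace {x + y |x y. x \<in> M \<and> y \<in> I}"
    using M I by (intro subspace_sums) (simp_all add: subalgebra_subspace ideal_subspace)
next
  fix u v assume "u \<in> {x + y |x y. x \<in> M \<and> y \<in> I}" "v \<in> {x + y |x y. x \<in> M \<and> y \<in> I}"
  then obtain a b c d where uv: "u = a + b" "v = c + d" and M': "a \<in> M" "c \<in> M"
    and I': "b \<in> I" "d \<in> I" by blast
  note cl = ideal_absorb[OF I I'(1)] ideal_absorb[OF I I'(2)] ideal_subspace[OF I]
  have "mult u v = mult a c + (mult a d + (mult b c + mult b d))"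
    by (simp add: uv mult_add_left mult_add_right algebra_simps)
  moreover have "mult a d + (mult b c + mult b d) \<in> I" using cl by (intro subspace_add)
  ultimately show "mult u v \<in> {x + y |x y. x \<in> M \<and> y \<in> I}"
    using M M' by (auto simp: subalgebra_def)
  have "bracket u v = bracket a c + (bracket a d + (bracket b c + bracket b d))"
    by (simp add: uv bracket_add_left bracket_add_right algebra_simps)
  moreover have "bracket a d + (bracket b c + bracket b d) \<in> I" using cl by (intro subspace_add)
  ultimately show "bracket u v \<in> {x + y |x y. x \<in> M \<and> y \<in> I}"
    using M M' by (auto simp: subalgebra_def)
qed

text \<open>An arbitrary factor \<open>p = z + b\<close> acts on \<open>A \<inter> B\<close> as its component \<open>b\<close> does, because \<open>A\<close> is
  annihilated by \<open>z\<close>; and \<open>b\<close> preserves both \<open>A\<close> and \<open>B\<close>.\<close>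

lemma ideal_Int_subalgebra:
  assumes A: "ideal A" and B: "subalgebra B" and Z: "A \<subseteq> annihilator Z"
    and sum: "\<And>p. \<exists>z\<in>Z. \<exists>b\<in>B. p = z + b"
  shows "ideal (A \<inter> B)"
  unfolding ideal_iff
proof (intro conjI ballI allI)
  show "subspace (A \<inter> B)" using A B by (simp add: subspace_inter ideal_subspace subalgebra_subspace)
next
  fix x p assume x: "x \<in> A \<inter> B"
  obtain z b where p: "z \<in> Z" "b \<in> B" "p = z + b" using sum[of p] by blast
  have "mult x p = mult x b" "bracket x p = bracket x b"
    using x p Z by (auto simp: annihilator_def mult_add_right bracket_add_right)
  then show "mult x p \<in> A \<inter> B" "bracket x p \<in> A \<inter> B"
    using x p A B by (auto simp: ideal_absorb subalgebra_def)
qed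

end

locale finite_dimensional_poisson_algebra =
  poisson_algebra scale mult bracket + finite_dimensional_vector_space scale Basis
  for scale :: "'k::field \<Rightarrow> 'p::ab_group_add \<Rightarrow> 'p" and mult bracket Basis
begin

lemma minimal_subspace_exists:
  assumes "Q S" and sub: "\<And>T. Q T \<Longrightarrow> subspace T"
  obtains M where "Q M" "\<And>T. Q T \<Longrightarrow> T \<subseteq> M \<Longrightarrow> T = M"
proof -
  obtain M where M: "Q M" and least: "\<And>T. Q T \<Longrightarrow> dim M \<le> dim T"
    using ex_has_least_nat[of Q S dim] \<open>Q S\<close> by blast
  show ?thesis
  proof (rule that[OF M])
    fix T assume T: "Q T" "T \<subseteq> M"
    show "T = M" by (rule subspace_dim_equal) (use T M sub least in auto)
  qed
qed

lemma minimal_ideal_exists: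
  assumes I: "ideal I" "I \<noteq> {0}"
  obtains K where "minimal_ideal K" "K \<subseteq> I"
proof -
  obtain K where K: "ideal K \<and> K \<noteq> {0} \<and> K \<subseteq> I"
    and min: "\<And>T. ideal T \<and> T \<noteq> {0} \<and> T \<subseteq> I \<Longrightarrow> T \<subseteq> K \<Longrightarrow> T = K"
    using minimal_subspace_exists[of "\<lambda>K. ideal K \<and> K \<noteq> {0} \<and> K \<subseteq> I" I] I
    by (auto simp: ideal_subspace)
  show ?thesis
    by (rule that[of K]) (use K min in \<open>auto simp: minimal_ideal_def\<close>)
qed

text \<open>The complement is a subalgebra \<open>B\<close> minimal subject to \<open>Z + B = P\<close>. Its intersection with \<open>Z\<close>
  is an ideal; if that were nonzero, being \<open>\<phi>\<close>-free would provide a maximal subalgebra \<open>M\<close> not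
  containing it, so that \<open>M + (Z \<inter> B) = P\<close>. By the modular law \<open>B \<inter> M\<close> would then still
  supplement \<open>Z\<close>, although it is smaller than \<open>B\<close>.\<close>

lemma zero_ideal_complement:
  assumes phi_free and Z: "zero_ideal Z"
  obtains B where "subalgebra B" "\<And>p. \<exists>z\<in>Z. \<exists>b\<in>B. p = z + b" "Z \<inter> B = {0}"
proof -
  have idZ: "ideal Z" and annZ: "Z \<subseteq> annihilator Z" using Z by (simp_all add: zero_ideal_iff)
  have sZ: "subspace Z" using idZ by (rule ideal_subspace)
  let ?Q = "\<lambda>B. subalgebra B \<and> (\<forall>p. \<exists>z\<in>Z. \<exists>b\<in>B. p = z + b)"
  have "?Q UNIV" using subspace_0[OF sZ] by (auto simp: subalgebra_def intro!: bexI[of _ 0])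
  then obtain B where QB: "?Q B" and min: "\<And>C. ?Q C \<Longrightarrow> C \<subseteq> B \<Longrightarrow> C = B"
    by (rule minimal_subspace_exists) (use subalgebra_subspace in blast)+
  have B: "subalgebra B" and sum: "\<And>p. \<exists>z\<in>Z. \<exists>b\<in>B. p = z + b" using QB by blast+
  have idZB: "ideal (Z \<inter> B)" by (rule ideal_Int_subalgebra[OF idZ B annZ sum])
  have "Z \<inter> B \<subseteq> frattini_subalgebra"
  proof (rule ccontr)
    assume "\<not> Z \<inter> B \<subseteq> frattini_subalgebra"
    then obtain M where M: "maximal_subalgebra M" and not: "\<not> Z \<inter> B \<subseteq> M"
      by (auto simp: frattini_subalgebra_def)
    have sM: "subalgebra M" using M by (simp add: maximal_subalgebra_def)
    let ?S = "{x + y |x y. x \<in> M \<and> y \<in> Z \<inter> B}"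
    have S: "subalgebra ?S" by (rule subalgebra_sum_ideal[OF sM idZB])
    have "M \<subseteq> ?S" using subspace_0[OF ideal_subspace[OF idZB]] by force
    moreover have "Z \<inter> B \<subseteq> ?S" using subspace_0[OF subalgebra_subspace[OF sM]] by force
    ultimately have "M \<subseteq> ?S" "?S \<noteq> M" using not by blast+
    then have top: "?S = UNIV" using M S unfolding maximal_subalgebra_def by blast
    have "\<exists>z\<in>Z. \<exists>b\<in>B \<inter> M. p = z + b" for p
    proof -
      obtain z b where p: "z \<in> Z" "b \<in> B" "p = z + b" using sum by blast
      obtain m y where b: "m \<in> M" "y \<in> Z" "y \<in> B" "b = m + y" using top by blast
      have "b - y \<in> B" by (rule subspace_diff[OF subalgebra_subspace[OF B] p(2) b(3)])
      then have "m \<in> B \<inter> M" using b by simp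
      moreover have "z + y \<in> Z" using p b sZ by (simp add: subspace_add)
      moreover have "p = (z + y) + m" using p b by (simp add: algebra_simps)
      ultimately show ?thesis by blast
    qed
    then have "B \<inter> M = B" by (intro min) (simp_all add: subalgebra_Int B sM)
    then show False using not by blast
  qed
  then have "Z \<inter> B \<subseteq> {0}"
    using frattini_ideal_greatest(3)[OF idZB] \<open>phi_free\<close> by (simp add: phi_free_def)
  moreover have "0 \<in> Z \<inter> B" by (rule subspace_0[OF ideal_subspace[OF idZB]])
  ultimately have "Z \<inter> B = {0}" by blast
  with B sum show ?thesis by (rule that)
qed

lemma annihilator_socle_subset_zero_socle:
  assumes phi_free
  shows "annihilator socle \<subseteq> zero_socle"
proof
  have Z: "zero_ideal zero_socle" by (rule zero_ideal_zero_socle)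
  obtain B where B: "subalgebra B" and sum: "\<And>p. \<exists>z\<in>zero_socle. \<exists>b\<in>B. p = z + b"
    and disj: "zero_socle \<inter> B = {0}"
    using zero_ideal_complement[OF assms Z] by blast
  let ?A = "annihilator socle"
  have A: "ideal ?A" by (rule ideal_annihilator[OF ideal_socle])
  have ZA: "zero_socle \<subseteq> ?A"
    using Z nilpotent_zero_ideal nilpotent_ideal_subset_annihilator_socle
    by (simp add: zero_ideal_iff)
  have AZ: "?A \<subseteq> annihilator zero_socle"
    using zero_socle_subset_socle by (auto simp: annihilator_def)
  have AB: "ideal (?A \<inter> B)" by (rule ideal_Int_subalgebra[OF A B AZ sum])
  have AB0: "?A \<inter> B = {0}"
  proof (rule ccontr)
    assume "?A \<inter> B \<noteq> {0}"
    then obtain K where K: "minimal_ideal K" "K \<subseteq> ?A \<inter> B" using minimal_ideal_exists AB by blast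
    have "K \<subseteq> socle" unfolding socle_def using K(1) by (auto intro: span_base)
    then have "K \<subseteq> annihilator K" using K(2) by (auto simp: annihilator_def)
    then have "zero_ideal K" using K(1) by (simp add: zero_ideal_iff minimal_ideal_ideal)
    then have "K \<subseteq> zero_socle" unfolding zero_socle_def using K(1) by (auto intro: span_base)
    then have "K \<subseteq> {0}" using K(2) disj by blast
    moreover have "0 \<in> K" using K(1) by (simp add: subspace_0 ideal_subspace minimal_ideal_ideal)
    ultimately show False using K(1) by (auto simp: minimal_ideal_def)
  qed
  fix x assume x: "x \<in> ?A"
  obtain z b where zb: "z \<in> zero_socle" "b \<in> B" "x = z + b" using sum by blast
  have "x - z \<in> ?A" using x zb ZA by (intro subspace_diff[OF ideal_subspace[OF A]]) auto
  then have "b \<in> ?A \<inter> B" using zb by simp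
  then show "x \<in> zero_socle" using AB0 zb by simp
qed

end

theorem theorem4p4:
  fixes scale :: "'k::field \<Rightarrow> 'p::ab_group_add \<Rightarrow> 'p"
    and mult bracket :: "'p \<Rightarrow> 'p \<Rightarrow> 'p"
  assumes "poisson_algebra scale mult bracket"
    and "\<exists>Basis. finite_dimensional_vector_space scale Basis"
    and "poisson_algebra.phi_free scale mult bracket"
  shows "poisson_algebra.zero_socle scale mult bracket = poisson_algebra.nilradical scale mult bracket
    \<and> poisson_algebra.nilradical scale mult bracket =
        poisson_algebra.annihilator mult bracket (poisson_algebra.socle scale mult bracket)"
proof -
  obtain Basis where "finite_dimensional_vector_space scale Basis" using assms(2) by blast
  then interpret finite_dimensional_poisson_algebra scale mult bracket Basis
    using assms(1) by (simp add: finite_dimensional_poisson_algebra_def)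
  have sub: "annihilator socle \<subseteq> zero_socle"
    by (rule annihilator_socle_subset_zero_socle[OF assms(3)])
  have Z: "ideal zero_socle" "nilpotent zero_socle"
    using zero_ideal_zero_socle by (simp_all add: zero_ideal_iff nilpotent_zero_ideal)
  have "nilradical = zero_socle"
    unfolding nilradical_def
    by (rule Greatest_equality)
      (use Z sub nilpotent_ideal_subset_annihilator_socle in blast)+
  moreover have "zero_socle = annihilator socle"
    using Z sub nilpotent_ideal_subset_annihilator_socle by blast
  ultimately show ?thesis by simp
qed

end
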